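(* In the model described in the context, if $3g-1\le k\le 8g-4$, then there is an algorithm that solves the $g$-partial gathering problem in dynamic (1-interval connected) rings within $O(n)$ rounds and with a total of $O(kn)$ agent moves.
   Context: Model. A dynamic bidirectional ring has anonymous nodes $v_0,\dots,v_{n-1}$ and links $e_i=\{v_i,v_{i+1 \bmod n}\}$; in each round an adversary may make at most one link missing (1-interval connectivity). Each node has a whiteboard that agents located there can read and write. There are $k\le n$ agents, which are deterministic finite automata with distinct IDs, knowledge of $n$ and $k$, and chirality (a common notion of forward $v_i\to v_{i+1}$ and backward $v_i\to v_{i-1}$). Agents cannot directly detect other agents at their node. Initially agents occupy pairwise distinct nodes, and a node's whiteboard is initially in one of two special states according to whether an agent starts there. Execution is fully synchronous: in each round every agent atomically reads the whiteboard, changes state, writes the whiteboard, and either stays or tries to move to a neighbouring node; if the link it tries to traverse is missing in that round it is blocked and stays. An agent terminates by entering a final state, after which it never acts. Problem. For a given positive integer $g<k$, an algorithm solves the $g$-partial gathering problem if every execution (against every adversary) is finite (all agents terminate) and in the final configuration every node hosting at least one agent hosts at least $g$ agents. Complexity measures: the number of rounds until all agents terminate, and the total number of moves (successful link traversals) made by all agents. *)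

theory Defs
  imports Main
begin

text \<open>
  Node \<open>v\<^sub>i\<close> is the number \<open>i < n\<close>; link \<open>e\<^sub>i\<close> joins \<open>v\<^sub>i\<close> and \<open>v\<^bsub>(i+1) mod n\<^esub>\<close> and is represented by
  its index \<open>i < n\<close>. Agents are identified with their IDs, which are arbitrary natural numbers.
\<close>

datatype direction = Backward | Stay | Forward

record ('s, 'w) automaton =
  init_state :: 's
  final_states :: "'s set"
  transition :: "'s \<Rightarrow> 'w \<Rightarrow> 's \<times> 'w \<times> direction"

text \<open>
  A program assigns an automaton to every ID. The automata know nothing but their own ID (and
  whatever parameters the program itself is built from): node names, the IDs of the other agents,
  the presence of other agents and the success of the last move are not among the inputs of
  \<open>transition\<close>.
\<close>

record ('s, 'w) program =
  wb_vacant :: 'w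
  wb_home :: 'w
  agent :: "nat \<Rightarrow> ('s, 'w) automaton"

text \<open>
  IDs are unbounded, so a single finite whiteboard alphabet cannot serve all of them. Whichever
  finitely many IDs take part, there are a finite alphabet \<open>W\<close> and finite state sets \<open>S a\<close> on which
  the participating agents are automata. The automata themselves do not depend on \<open>I\<close>.
\<close>

definition finite_automata :: "('s, 'w) program \<Rightarrow> bool" where
  "finite_automata P \<longleftrightarrow>
     wb_vacant P \<noteq> wb_home P \<and>
     (\<forall>I. finite I \<longrightarrow>
       (\<exists>S W. finite W \<and> wb_vacant P \<in> W \<and> wb_home P \<in> W \<and>
         (\<forall>a\<in>I. finite (S a) \<and> init_state (agent P a) \<in> S a \<and> final_states (agent P a) \<subseteq> S a \<and>
           (\<forall>s\<in>S a. \<forall>w\<in>W. transition (agent P a) s w \<in> S a \<times> W \<times> UNIV))))"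

text \<open>
  The field \<open>moves\<close> only records how many links have been traversed so far; it has no influence on
  the execution.
\<close>

record ('s, 'w) config =
  loc :: "nat \<Rightarrow> nat"
  state :: "nat \<Rightarrow> 's"
  board :: "nat \<Rightarrow> 'w"
  moves :: nat

text \<open>
  Everything that the algorithm does not control: the agents taking part, their starting nodes and
  the adversary's choices, namely the link missing in each round (if any) and the order in which
  the agents perform their atomic actions in that round.
\<close>

record scenario =
  agents :: "nat set"
  home :: "nat \<Rightarrow> nat"
  missing :: "nat \<Rightarrow> nat option"
  action_order :: "nat \<Rightarrow> nat list"

definition valid_scenario :: "nat \<Rightarrow> nat \<Rightarrow> scenario \<Rightarrow> bool" where
  "valid_scenario n k E \<longleftrightarrow>
     finite (agents E) \<and> card (agents E) = k \<and>
     inj_on (home E) (agents E) \<and> home E ` agents E \<subseteq> {..<n} \<and>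
     (\<forall>r e. missing E r = Some e \<longrightarrow> e < n) \<and>
     (\<forall>r. distinct (action_order E r) \<and> set (action_order E r) = agents E)"

fun link_used :: "nat \<Rightarrow> nat \<Rightarrow> direction \<Rightarrow> nat option" where
  "link_used n v Forward = Some v"
| "link_used n v Backward = Some ((v + n - 1) mod n)"
| "link_used n v Stay = None"

fun neighbour :: "nat \<Rightarrow> nat \<Rightarrow> direction \<Rightarrow> nat" where
  "neighbour n v Forward = (v + 1) mod n"
| "neighbour n v Backward = (v + n - 1) mod n"
| "neighbour n v Stay = v"

definition traverses :: "nat \<Rightarrow> nat option \<Rightarrow> nat \<Rightarrow> direction \<Rightarrow> bool" where
  "traverses n m v d \<longleftrightarrow> d \<noteq> Stay \<and> link_used n v d \<noteq> m"

definition act ::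
  "('s, 'w) program \<Rightarrow> nat \<Rightarrow> nat option \<Rightarrow> nat \<Rightarrow> ('s, 'w) config \<Rightarrow> ('s, 'w) config" where
  "act P n m a C =
     (if state C a \<in> final_states (agent P a) then C
      else let v = loc C a;
               (s, w, d) = transition (agent P a) (state C a) (board C v)
           in \<lparr>loc = (if traverses n m v d then (loc C)(a := neighbour n v d) else loc C),
               state = (state C)(a := s),
               board = (board C)(v := w),
               moves = (if traverses n m v d then moves C + 1 else moves C)\<rparr>)"

definition initial_config :: "('s, 'w) program \<Rightarrow> scenario \<Rightarrow> ('s, 'w) config" where
  "initial_config P E =
     \<lparr>loc = home E,
      state = (\<lambda>a. init_state (agent P a)),
      board = (\<lambda>v. if v \<in> home E ` agents E then wb_home P else wb_vacant P),
      moves = 0\<rparr>"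

text \<open>
  Every agent acts exactly once per round, at the node where it is when the round begins, and writes
  only there. Hence performing the actions one after the other matters only for agents sharing a
  node.
\<close>

fun execution :: "('s, 'w) program \<Rightarrow> nat \<Rightarrow> scenario \<Rightarrow> nat \<Rightarrow> ('s, 'w) config" where
  "execution P n E 0 = initial_config P E"
| "execution P n E (Suc r) = fold (act P n (missing E r)) (action_order E r) (execution P n E r)"

definition all_terminated :: "('s, 'w) program \<Rightarrow> scenario \<Rightarrow> ('s, 'w) config \<Rightarrow> bool" where
  "all_terminated P E C \<longleftrightarrow> (\<forall>a\<in>agents E. state C a \<in> final_states (agent P a))"

text \<open>
  The following two are meaningful only for executions in which all agents eventually terminate.
\<close>

definition rounds :: "('s, 'w) program \<Rightarrow> nat \<Rightarrow> scenario \<Rightarrow> nat" where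
  "rounds P n E = (LEAST t. all_terminated P E (execution P n E t))"

definition final_config :: "('s, 'w) program \<Rightarrow> nat \<Rightarrow> scenario \<Rightarrow> ('s, 'w) config" where
  "final_config P n E = execution P n E (rounds P n E)"

definition partially_gathered :: "nat \<Rightarrow> scenario \<Rightarrow> ('s, 'w) config \<Rightarrow> bool" where
  "partially_gathered g E C \<longleftrightarrow>
     (\<forall>v. (\<exists>a\<in>agents E. loc C a = v) \<longrightarrow> g \<le> card {a \<in> agents E. loc C a = v})"

definition solves_partial_gathering :: "('s, 'w) program \<Rightarrow> nat \<Rightarrow> nat \<Rightarrow> nat \<Rightarrow> bool" where
  "solves_partial_gathering P n k g \<longleftrightarrow>
     (\<forall>E. valid_scenario n k E \<longrightarrow>
        (\<exists>t. all_terminated P E (execution P n E t)) \<and>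
        partially_gathered g E (final_config P n E))"

end

theory Submission
  imports Defs "HOL-Library.FSet"
begin

text \<open>
  In the first round every agent writes its ID on the whiteboard of its home. Then all agents try to
  walk forward for \<open>4n\<close> rounds; an agent that is back home knows the least ID and walks on to the
  home \<open>T\<close> of its owner, where it stays, after fewer than \<open>2n\<close> moves in all. Two walking agents at
  the same node keep moving together, and two at different nodes cannot both be blocked in the same
  round. Hence two agents that have not reached \<open>T\<close> after \<open>4n\<close> rounds are at the same node, and all
  agents occupy at most two nodes.

  The agents now sign a roster at their node and thereby learn the size of their own group. If both
  groups have at least \<open>g\<close> members, nobody moves any more. Otherwise one of them has more than
  \<open>k - g \<ge> 2g - 1\<close> members: \<open>g\<close> of them set out forward and the others, at least \<open>g\<close>, backward,
  until they meet the small group, which stays. The two parts use disjoint arcs of the ring, so at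
  most one of them is blocked in any round, and after \<open>n\<close> rounds at least one has joined the small
  group. The total number of rounds is \<open>5n + 3\<close>, and each agent makes at most one move per round.
\<close>

section \<open>Encoding programs over countable types\<close>

text \<open>The algorithm is written with datatypes, while the theorem asks for states and boards in
  \<open>nat\<close>. Because \<open>from_nat\<close> undoes \<open>to_nat\<close>, encoding
  commutes with every action; codes outside the image of \<open>to_nat\<close> never occur in an
  execution.\<close>

definition encode_automaton ::
  "('s::countable, 'w::countable) automaton \<Rightarrow> (nat, nat) automaton" where
  "encode_automaton M =
     \<lparr>init_state = to_nat (init_state M),
      final_states = to_nat ` final_states M,
      transition = (\<lambda>s w. case transition M (from_nat s) (from_nat w) of
        (s', w', d) \<Rightarrow> (to_nat s', to_nat w', d))\<rparr>"

definition encode_program :: "('s::countable, 'w::countable) program \<Rightarrow> (nat, nat) program" where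
  "encode_program P =
     \<lparr>wb_vacant = to_nat (wb_vacant P),
      wb_home = to_nat (wb_home P),
      agent = (\<lambda>a. encode_automaton (agent P a))\<rparr>"

definition encode_config :: "('s::countable, 'w::countable) config \<Rightarrow> (nat, nat) config" where
  "encode_config C =
     \<lparr>loc = loc C, state = (\<lambda>a. to_nat (state C a)), board = (\<lambda>v. to_nat (board C v)),
      moves = moves C\<rparr>"

lemma act_encode_program:
  "act (encode_program P) n m a (encode_config C) = encode_config (act P n m a C)"
  by (auto simp: act_def encode_program_def encode_automaton_def encode_config_def Let_def
      inj_image_mem_iff fun_eq_iff split: prod.splits)

lemma fold_act_encode_program:
  "fold (act (encode_program P) n m) xs (encode_config C) =
     encode_config (fold (act P n m) xs C)"
  by (induction xs arbitrary: C) (simp_all add: act_encode_program)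

lemma execution_encode_program:
  "execution (encode_program P) n E t = encode_config (execution P n E t)"
proof (induction t)
  case 0
  show ?case
    by (auto simp: initial_config_def encode_program_def encode_automaton_def encode_config_def)
qed (simp add: fold_act_encode_program)

lemma all_terminated_encode_program:
  "all_terminated (encode_program P) E (encode_config C) \<longleftrightarrow> all_terminated P E C"
  by (simp add: all_terminated_def encode_program_def encode_automaton_def encode_config_def
      inj_image_mem_iff)

lemma rounds_encode_program: "rounds (encode_program P) n E = rounds P n E"
  by (simp add: rounds_def execution_encode_program all_terminated_encode_program)

lemma final_config_encode_program:
  "final_config (encode_program P) n E = encode_config (final_config P n E)"
  by (simp add: final_config_def rounds_encode_program execution_encode_program)

lemma moves_encode_config: "moves (encode_config C) = moves C"
  by (simp add: encode_config_def)

lemma solves_partial_gathering_encode_program: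
  "solves_partial_gathering (encode_program P) n k g \<longleftrightarrow> solves_partial_gathering P n k g"
  by (simp add: solves_partial_gathering_def execution_encode_program
      all_terminated_encode_program final_config_encode_program partially_gathered_def
      encode_config_def[of "final_config P n _"])

text \<open>Finiteness and closure under transitions pass to the images of \<open>S a\<close> and
  \<open>W\<close> under \<open>to_nat\<close>.\<close>

lemma finite_automata_encode_program:
  assumes "finite_automata P"
  shows "finite_automata (encode_program P)"
  unfolding finite_automata_def
proof (intro conjI allI impI)
  show "wb_vacant (encode_program P) \<noteq> wb_home (encode_program P)"
    using assms by (simp add: finite_automata_def encode_program_def)
  fix I :: "nat set"
  assume "finite I"
  then obtain S W where "finite W" "wb_vacant P \<in> W" "wb_home P \<in> W"
    and S: "\<And>a. a \<in> I \<Longrightarrow> finite (S a) \<and> init_state (agent P a) \<in> S a \<and>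
      final_states (agent P a) \<subseteq> S a \<and>
      (\<forall>s\<in>S a. \<forall>w\<in>W. transition (agent P a) s w \<in> S a \<times> W \<times> UNIV)"
    using assms unfolding finite_automata_def by metis
  then show "\<exists>S W. finite W \<and> wb_vacant (encode_program P) \<in> W \<and>
      wb_home (encode_program P) \<in> W \<and>
      (\<forall>a\<in>I. finite (S a) \<and> init_state (agent (encode_program P) a) \<in> S a \<and>
        final_states (agent (encode_program P) a) \<subseteq> S a \<and>
        (\<forall>s\<in>S a. \<forall>w\<in>W. transition (agent (encode_program P) a) s w \<in> S a \<times> W \<times> UNIV))"
    apply (intro exI[of _ "\<lambda>a. to_nat ` S a"] exI[of _ "to_nat ` W"])
    apply (simp add: encode_program_def encode_automaton_def split: prod.split)
    by fastforce
qed

section \<open>Synchronous rounds\<close>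

definition destination :: "nat \<Rightarrow> nat option \<Rightarrow> nat \<Rightarrow> direction \<Rightarrow> nat" where
  "destination n m v d = (if traverses n m v d then neighbour n v d else v)"

lemma destination_Stay [simp]: "destination n m v Stay = v"
  by (simp add: destination_def traverses_def)

text \<open>
  The set \<open>V v\<close> collects the boards that may be found at \<open>v\<close> during the round; as long as new state
  and direction do not depend on the choice from \<open>V v\<close>, neither does the order of the actions
  matter for them.
\<close>

lemma fold_act:
  assumes "distinct xs"
    and "\<And>v. board C v \<in> V v"
    and "\<And>a. a \<in> set xs \<Longrightarrow> state C a \<notin> final_states (agent P a)"
    and "\<And>a w. a \<in> set xs \<Longrightarrow> w \<in> V (loc C a) \<Longrightarrow>
      transition (agent P a) (state C a) w = (s a, u a w, d a) \<and> u a w \<in> V (loc C a)"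
  shows "(\<forall>a\<in>set xs. state (fold (act P n m) xs C) a = s a \<and>
            loc (fold (act P n m) xs C) a = destination n m (loc C a) (d a)) \<and>
         (\<forall>a. a \<notin> set xs \<longrightarrow> state (fold (act P n m) xs C) a = state C a \<and>
            loc (fold (act P n m) xs C) a = loc C a) \<and>
         (\<forall>v. board (fold (act P n m) xs C) v =
            fold u (filter (\<lambda>a. loc C a = v) xs) (board C v))"
  using assms
proof (induction xs arbitrary: C)
  case Nil
  then show ?case by simp
next
  case (Cons x xs)
  define C1 where "C1 = act P n m x C"
  have loc1: "loc C1 = (loc C)(x := destination n m (loc C x) (d x))"
    and state1: "state C1 = (state C)(x := s x)"
    and board1: "board C1 = (board C)(loc C x := u x (board C (loc C x)))"
    using Cons.prems by (auto simp: C1_def act_def destination_def Let_def)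
  have same: "loc C1 a = loc C a" "state C1 a = state C a" if "a \<in> set xs" for a
    using that Cons.prems(1) by (auto simp: loc1 state1)
  have IH: "(\<forall>a\<in>set xs. state (fold (act P n m) xs C1) a = s a \<and>
            loc (fold (act P n m) xs C1) a = destination n m (loc C1 a) (d a)) \<and>
         (\<forall>a. a \<notin> set xs \<longrightarrow> state (fold (act P n m) xs C1) a = state C1 a \<and>
            loc (fold (act P n m) xs C1) a = loc C1 a) \<and>
         (\<forall>v. board (fold (act P n m) xs C1) v =
            fold u (filter (\<lambda>a. loc C1 a = v) xs) (board C1 v))"
  proof (rule Cons.IH)
    show "distinct xs" using Cons.prems(1) by simp
    show "board C1 v \<in> V v" for v
      using Cons.prems(2)[of v] Cons.prems(4)[of x "board C (loc C x)"] Cons.prems(2)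
      by (auto simp: board1)
  qed (use Cons.prems(3,4) same in auto)
  \<comment> \<open>Agents yet to act have not moved, so who writes on a board is determined by the
    positions at the beginning of the round.\<close>
  have filt: "filter (\<lambda>a. loc C1 a = v) xs = filter (\<lambda>a. loc C a = v) xs" for v
    by (rule filter_cong) (auto simp: same)
  have xs: "x \<notin> set xs" using Cons.prems(1) by simp
  show ?case
    using IH xs unfolding filt
    by (auto simp: C1_def[symmetric] same board1) (auto simp: loc1 state1)
qed

lemma moves_fold_act: "moves (fold (act P n m) xs C) \<le> moves C + length xs"
proof (induction xs arbitrary: C)
  case (Cons x xs)
  have "moves (act P n m x C) \<le> moves C + 1"
    by (auto simp: act_def Let_def split: prod.splits)
  then show ?case using Cons[of "act P n m x C"] by simp
qed simp

lemma moves_execution: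
  assumes "valid_scenario n k E"
  shows "moves (execution P n E t) \<le> k * t"
proof (induction t)
  case (Suc t)
  have "length (action_order E t) = k"
    using assms by (metis valid_scenario_def distinct_card)
  then show ?case
    using Suc moves_fold_act[of P n "missing E t" "action_order E t" "execution P n E t"] by simp
qed (simp add: initial_config_def)

declare execution.simps [simp del]

section \<open>The algorithm\<close>

datatype lap = At_Home | Away | Returned

text \<open>\<open>Enlisted\<close> separates signing from reading: a roster is read only one round
  after everybody has signed, so it is complete whatever the order of actions was.\<close>

datatype memory = Start | Walk nat nat lap | Enlisted | Sweep nat direction

instance direction :: countable by countable_datatype
instance lap :: countable by countable_datatype
instance memory :: countable by countable_datatype

text \<open>
  A whiteboard holds the ID of the agent that started there, if any, and a roster of IDs; the
  initial entry \<open>Some 0\<close> at a home is overwritten by its owner in the first round. In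
  \<open>Walk t m l\<close>, \<open>t\<close> counts rounds and \<open>m\<close> is the least ID seen so far.
\<close>

type_synonym whiteboard = "nat option \<times> nat fset"

fun update_least :: "nat \<Rightarrow> nat option \<Rightarrow> nat" where
  "update_least m None = m"
| "update_least m (Some b) = min m b"

text \<open>An agent cannot tell whether it was blocked. It counts as \<open>Away\<close> once it
  sees a board without its own ID, so that a later sight of this ID means a completed lap and not a
  blocked start.\<close>

fun update_lap :: "nat \<Rightarrow> lap \<Rightarrow> nat option \<Rightarrow> lap" where
  "update_lap a At_Home h = (if h = Some a then At_Home else Away)"
| "update_lap a Away h = (if h = Some a then Returned else Away)"
| "update_lap a Returned h = Returned"

text \<open>With two groups, the bound \<open>k - g\<close> says that the other group has at least
  \<open>g\<close> members. A group marked in this way can thus either stay or wait for others; the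
  empty roster marks a node to be passed.\<close>

definition small_roster :: "nat \<Rightarrow> nat \<Rightarrow> nat fset \<Rightarrow> bool" where
  "small_roster k g Q \<longleftrightarrow> Q \<noteq> {||} \<and> fcard Q \<le> k - g"

text \<open>The last clause leaves \<open>Sweep n d\<close> unchanged because
  \<open>finite_automata\<close> demands closure in final states too.\<close>

fun gather_step ::
  "nat \<Rightarrow> nat \<Rightarrow> nat \<Rightarrow> nat \<Rightarrow> memory \<Rightarrow> whiteboard \<Rightarrow> memory \<times> whiteboard \<times> direction" where
  "gather_step n k g a Start (h, Q) = (Walk 0 a At_Home, (Some a, Q), Stay)"
| "gather_step n k g a (Walk t m l) (h, Q) =
     (if t < 4 * n then
        (let m' = update_least m h; l' = update_lap a l h
         in (Walk (t + 1) m' l', (h, Q),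
             if l' = Returned \<and> h = Some m' then Stay else Forward))
      else (Enlisted, (h, finsert a Q), Stay))"
| "gather_step n k g a Enlisted (h, Q) =
     (Sweep 0 (if card {x \<in> fset Q. x < a} < g then Forward else Backward), (h, Q), Stay)"
| "gather_step n k g a (Sweep j d) (h, Q) =
     (if j < n then Sweep (j + 1) d else Sweep j d, (h, Q), if small_roster k g Q then Stay else d)"

definition gather :: "nat \<Rightarrow> nat \<Rightarrow> nat \<Rightarrow> (memory, whiteboard) program" where
  "gather n k g =
     \<lparr>wb_vacant = (None, {||}),
      wb_home = (Some 0, {||}),
      agent = (\<lambda>a. \<lparr>init_state = Start, final_states = range (Sweep n),
        transition = gather_step n k g a\<rparr>)\<rparr>"

lemma UNIV_direction: "UNIV = {Backward, Stay, Forward}"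
  using direction.exhaust by auto

lemma UNIV_lap: "UNIV = {At_Home, Away, Returned}"
  using lap.exhaust by auto

lemma finite_fset_over: "finite I \<Longrightarrow> finite {Q. fset Q \<subseteq> I}"
  by (rule finite_imageD[of fset])
    (auto intro: finite_subset[of _ "Pow I"] inj_onI simp: fset_inject)

lemma finite_automata_gather: "finite_automata (gather n k g)"
  unfolding finite_automata_def
proof (intro conjI allI impI)
  show "wb_vacant (gather n k g) \<noteq> wb_home (gather n k g)" by (simp add: gather_def)
  fix I :: "nat set"
  assume "finite I"
  \<comment> \<open>\<open>0\<close> is the placeholder ID on the initial board of a home and need
    not belong to \<open>I\<close>.\<close>
  define J where "J = insert 0 I"
  define W where "W = insert None (Some ` J) \<times> {Q. fset Q \<subseteq> J}"
  define S where "S = {Start, Enlisted} \<union> (\<lambda>(t, m, l). Walk t m l) ` ({..4 * n} \<times> J \<times> UNIV) \<union>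
    (\<lambda>(j, d). Sweep j d) ` ({..n} \<times> UNIV)"
  have "finite J" using \<open>finite I\<close> by (simp add: J_def)
  then have "finite W" by (simp add: W_def finite_fset_over)
  have "finite S"
    using \<open>finite J\<close> by (simp add: S_def UNIV_direction UNIV_lap)
  have Walk: "Walk t m l \<in> S \<longleftrightarrow> t \<le> 4 * n \<and> m \<in> J" for t m l
    by (force simp: S_def)
  have Sweep: "Sweep j d \<in> S \<longleftrightarrow> j \<le> n" for j d
    by (force simp: S_def)
  have other: "Start \<in> S" "Enlisted \<in> S" by (auto simp: S_def)
  have least: "update_least m h \<in> J" if "m \<in> J" "h \<in> insert None (Some ` J)" for m h
    using that by (cases h) (auto simp: min_def)
  have closed: "gather_step n k g a s w \<in> S \<times> W \<times> UNIV" if "a \<in> I" "s \<in> S" "w \<in> W" for a s w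
  proof -
    obtain h Q where w: "w = (h, Q)" by (cases w)
    have hQ: "h \<in> insert None (Some ` J)" "fset Q \<subseteq> J" using that w by (auto simp: W_def)
    have "a \<in> J" using that by (simp add: J_def)
    then show ?thesis
      using that hQ least[OF _ hQ(1)]
      by (cases s) (auto simp: w W_def Walk Sweep other Let_def)
  qed
  show "\<exists>S W. finite W \<and> wb_vacant (gather n k g) \<in> W \<and> wb_home (gather n k g) \<in> W \<and>
      (\<forall>a\<in>I. finite (S a) \<and> init_state (agent (gather n k g) a) \<in> S a \<and>
        final_states (agent (gather n k g) a) \<subseteq> S a \<and>
        (\<forall>s\<in>S a. \<forall>w\<in>W. transition (agent (gather n k g) a) s w \<in> S a \<times> W \<times> UNIV))"
    using \<open>finite W\<close> \<open>finite S\<close> closed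
    by (intro exI[of _ "\<lambda>_. S"] exI[of _ W])
      (auto simp: gather_def Sweep other, auto simp: W_def J_def)
qed

text \<open>A new maximum \<open>b\<close> changes no other rank and has itself rank
  \<open>card Q\<close>, so it is counted iff \<open>card Q < g\<close>. Members of a large group
  thereby elect exactly \<open>g\<close> of themselves from the roster alone.\<close>

lemma card_rank_less:
  fixes Q :: "'a::linorder set"
  assumes "finite Q"
  shows "card {a \<in> Q. card {x \<in> Q. x < a} < g} = min g (card Q)"
  using assms
proof (induction rule: finite_linorder_max_induct)
  case (insert b Q)
  have b: "b \<notin> Q" using insert by auto
  have "{x \<in> insert b Q. x < a} = {x \<in> Q. x < a}" if "a \<in> Q" for a
    using insert that by auto
  moreover have "{x \<in> insert b Q. x < b} = Q" using insert by auto
  ultimately have "{a \<in> insert b Q. card {x \<in> insert b Q. x < a} < g} =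
      {a \<in> Q. card {x \<in> Q. x < a} < g} \<union> (if card Q < g then {b} else {})"
    by (auto cong: conj_cong)
  then show ?case using insert b by (auto simp: min_def)
qed simp

section \<open>Arithmetic of positions on the ring\<close>

lemma add_mod_inject:
  fixes x i j n :: nat
  assumes "(x + i) mod n = (x + j) mod n" "i < n" "j < n"
  shows "i = j"
proof -
  have "i = j" if "j \<le> i" "(x + i) mod n = (x + j) mod n" "i < n" for i j :: nat
  proof -
    have "n dvd i - j" using that mod_eq_dvd_iff_nat[of "x + j" "x + i" n] by simp
    then show ?thesis using that by (auto dest: dvd_imp_le)
  qed
  then show ?thesis using assms by (metis nat_le_linear)
qed

text \<open>Positions are kept as unreduced offsets from a base node, so that laps and numbers of
  moves remain visible.\<close>

lemma destination_Forward:
  "destination n m ((x + p) mod n) Forward =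
     (x + (if m = Some ((x + p) mod n) then p else p + 1)) mod n"
  by (auto simp: destination_def traverses_def mod_simps)

lemma pred_mod_nat:
  fixes x r n :: nat
  assumes "0 < r" "0 < n"
  shows "((x + r) mod n + n - 1) mod n = (x + (r - 1)) mod n"
proof -
  have "((x + r) mod n + n - 1) mod n = ((x + r) mod n + (n - 1)) mod n"
    using assms by simp
  also have "\<dots> = (x + r + (n - 1)) mod n" by (simp add: mod_simps)
  also have "x + r + (n - 1) = x + (r - 1) + n" using assms by simp
  finally show ?thesis by simp
qed

lemma destination_Backward:
  assumes "0 < r" "0 < n"
  shows "destination n m ((x + r) mod n) Backward =
     (x + (if m = Some ((x + (r - 1)) mod n) then r else r - 1)) mod n"
  using assms pred_mod_nat[OF assms, of x] by (auto simp: destination_def traverses_def)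

section \<open>Analysis\<close>

locale gathering =
  fixes n k g :: nat and E :: scenario
  assumes valid: "valid_scenario n k E"
    and g_pos: "0 < g" and g_less: "g < k" and k_le: "k \<le> n" and k_ge: "3 * g - 1 \<le> k"
begin

abbreviation "A \<equiv> agents E"
abbreviation "hm \<equiv> home E"
abbreviation "X t \<equiv> execution (gather n k g) n E t"

lemma finite_A: "finite A" and card_A: "card A = k" and inj_hm: "inj_on hm A"
  and hm_less: "a \<in> A \<Longrightarrow> hm a < n"
  and distinct_order: "distinct (action_order E t)" and set_order: "set (action_order E t) = A"
  using valid by (auto simp: valid_scenario_def)

lemma n_ge2: "2 \<le> n" using g_pos g_less k_le by linarith

lemma A_nonempty: "A \<noteq> {}" using card_A g_less by auto

lemma round_step:
  assumes "\<And>v. board (X t) v \<in> V v"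
    and "\<And>a. a \<in> A \<Longrightarrow> state (X t) a \<notin> range (Sweep n)"
    and "\<And>a w. a \<in> A \<Longrightarrow> w \<in> V (loc (X t) a) \<Longrightarrow>
      gather_step n k g a (state (X t) a) w = (s a, u a w, d a) \<and> u a w \<in> V (loc (X t) a)"
  shows "a \<in> A \<Longrightarrow> state (X (Suc t)) a = s a"
    and "a \<in> A \<Longrightarrow> loc (X (Suc t)) a = destination n (missing E t) (loc (X t) a) (d a)"
    and "board (X (Suc t)) v =
      fold u (filter (\<lambda>a. loc (X t) a = v) (action_order E t)) (board (X t) v)"
  using fold_act[of "action_order E t" "X t" V "gather n k g" s u d n "missing E t"] assms
  by (auto simp: execution.simps distinct_order set_order gather_def)

text \<open>Nobody changes a board, so the set of boards possible at \<open>v\<close> during the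
  round is a singleton.\<close>

lemma silent_round_step:
  assumes "\<And>a. a \<in> A \<Longrightarrow> state (X t) a \<notin> range (Sweep n)"
    and "\<And>a. a \<in> A \<Longrightarrow> gather_step n k g a (state (X t) a) (board (X t) (loc (X t) a)) =
      (s a, board (X t) (loc (X t) a), d a)"
  shows "a \<in> A \<Longrightarrow> state (X (Suc t)) a = s a"
    and "a \<in> A \<Longrightarrow> loc (X (Suc t)) a = destination n (missing E t) (loc (X t) a) (d a)"
    and "board (X (Suc t)) = board (X t)"
proof -
  have id: "fold (\<lambda>_ w. w) xs w = w" for xs :: "nat list" and w :: whiteboard
    by (induction xs) auto
  note * = round_step[where t = t and V = "\<lambda>v. {board (X t) v}" and u = "\<lambda>_ w. w"
      and s = s and d = d]
  show "a \<in> A \<Longrightarrow> state (X (Suc t)) a = s a"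
    and "a \<in> A \<Longrightarrow> loc (X (Suc t)) a = destination n (missing E t) (loc (X t) a) (d a)"
    using assms by (auto intro!: *)
  show "board (X (Suc t)) = board (X t)"
    by (rule ext, subst *(3)) (use assms id in auto)
qed

text \<open>The ID entry of node \<open>v\<close> once the owners have overwritten the
  placeholders.\<close>

definition mark :: "nat \<Rightarrow> nat option" where
  "mark v = (if v \<in> hm ` A then Some (the_inv_into A hm v) else None)"

lemma mark_eq_Some: "mark v = Some b \<longleftrightarrow> b \<in> A \<and> hm b = v"
  by (auto simp: mark_def the_inv_into_f_f[OF inj_hm] inj_on_eq_iff[OF inj_hm])

lemma start_round:
  shows "a \<in> A \<Longrightarrow> state (X 1) a = Walk 0 a At_Home"
    and "a \<in> A \<Longrightarrow> loc (X 1) a = hm a"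
    and "board (X 1) v = (mark v, {||})"
proof -
  define u :: "nat \<Rightarrow> whiteboard \<Rightarrow> whiteboard" where "u = (\<lambda>a w. (Some a, snd w))"
  have init: "state (X 0) a = Start" "loc (X 0) a = hm a"
    "board (X 0) v = (if v \<in> hm ` A then Some 0 else None, {||})" for a v
    by (simp_all add: execution.simps initial_config_def gather_def)
  note * = round_step[where t = 0 and V = "\<lambda>_. UNIV" and u = u
      and s = "\<lambda>a. Walk 0 a At_Home" and d = "\<lambda>_. Stay"]
  have step: "gather_step n k g a (state (X 0) a) w = (Walk 0 a At_Home, u a w, Stay)" for a w
    by (cases w) (simp add: init u_def)
  have nonfinal: "state (X 0) a \<notin> range (Sweep n)" for a
    by (auto simp: init)
  show "a \<in> A \<Longrightarrow> state (X 1) a = Walk 0 a At_Home"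
    using *(1)[of a] step nonfinal by simp
  show "a \<in> A \<Longrightarrow> loc (X 1) a = hm a"
    using *(2)[of a] step nonfinal init by simp
  \<comment> \<open>The last writer determines the entry, and every writer at \<open>v\<close> has
    its home there.\<close>
  have fold_u: "fold u ys w = (if ys = [] then fst w else Some (last ys), snd w)" for ys w
    by (induction ys arbitrary: w) (auto simp: u_def)
  define ys where "ys = filter (\<lambda>a. loc (X 0) a = v) (action_order E 0)"
  have set_ys: "set ys = {a \<in> A. hm a = v}" by (simp add: ys_def set_order init)
  have "board (X 1) v = fold u ys (board (X 0) v)"
    using *(3)[of v] step nonfinal unfolding ys_def by simp
  also have "\<dots> = (mark v, {||})"
  proof (cases "ys = []")
    case True
    then have "v \<notin> hm ` A" using set_ys by auto
    then show ?thesis using True by (simp add: fold_u init mark_def)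
  next
    case False
    then have "last ys \<in> A \<and> hm (last ys) = v" using set_ys last_in_set[of ys] by auto
    then have "mark v = Some (last ys)" by (simp add: mark_eq_Some)
    then show ?thesis using False by (simp add: fold_u init)
  qed
  finally show "board (X 1) v = (mark v, {||})" .
qed

subsection \<open>Walking to the home of the least ID\<close>

definition target :: nat where "target = hm (Min A)"

text \<open>The forward distance from the home of \<open>a\<close> to \<open>target\<close>; the
  agent stops after \<open>n + offset a\<close> moves, one lap and then this distance.\<close>

definition offset :: "nat \<Rightarrow> nat" where "offset a = (target + n - hm a) mod n"

lemma Min_in_A: "Min A \<in> A" using finite_A A_nonempty by simp

lemma offset_less: "offset a < n" using n_ge2 by (simp add: offset_def)

lemma offset_eq: "a \<in> A \<Longrightarrow> (hm a + offset a) mod n = target"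
  using hm_less[of a] hm_less[OF Min_in_A] by (simp add: offset_def target_def mod_simps)

lemma home_offset:
  assumes "a \<in> A" "b \<in> A"
  obtains j where "j < n" "hm b = (hm a + j) mod n"
proof
  show "(hm b + n - hm a) mod n < n" using n_ge2 by simp
  show "hm b = (hm a + (hm b + n - hm a) mod n) mod n"
    using hm_less[OF assms(1)] hm_less[OF assms(2)] by (simp add: mod_simps)
qed

text \<open>The ghost variable \<open>p\<close> is the number of moves made so far by agent \<open>a\<close>.\<close>

definition walker :: "nat \<Rightarrow> nat \<Rightarrow> nat \<Rightarrow> lap \<Rightarrow> bool" where
  "walker a p m l \<longleftrightarrow> m \<in> A \<and>
     (\<forall>b\<in>A. \<forall>j<p. hm b = (hm a + j) mod n \<longrightarrow> m \<le> b) \<and> p \<le> n + offset a \<and>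
     (case l of At_Home \<Rightarrow> p \<le> 1 | Away \<Rightarrow> 1 \<le> p \<and> p \<le> n | Returned \<Rightarrow> n \<le> p)"

text \<open>In \<open>walker\<close>, \<open>m\<close> and \<open>l\<close> have not yet taken the
  present board into account; hence \<open>j<p\<close>, and hence \<open>At_Home\<close> allows
  \<open>p = 1\<close> and \<open>Away\<close> allows \<open>p = n\<close>. Reading a board twice
  does no harm, so the invariant survives both a blocked round and a move.\<close>

lemma walker_step:
  fixes p :: nat
  assumes a: "a \<in> A" and w: "walker a p m l"
  defines "h \<equiv> mark ((hm a + p) mod n)"
  defines "m' \<equiv> update_least m h" and "l' \<equiv> update_lap a l h"
  shows "l' = Returned \<and> h = Some m' \<longleftrightarrow> p = n + offset a"
    and "walker a p m' l'"
    and "p \<noteq> n + offset a \<Longrightarrow> walker a (p + 1) m' l'"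
proof -
  have m'_le: "m' \<le> m" unfolding m'_def by (cases h) auto
  have m'_A: "m' \<in> A"
  proof (cases h)
    case None
    then show ?thesis using w by (simp add: m'_def walker_def)
  next
    case (Some b)
    then have "b \<in> A" by (simp add: h_def mark_eq_Some)
    then show ?thesis using w Some by (simp add: m'_def walker_def min_def)
  qed
  have least: "m' \<le> b" if "b \<in> A" "j < p + 1" "hm b = (hm a + j) mod n" for b j
  proof (cases "j = p")
    case True
    then have "h = Some b" using that by (simp add: h_def mark_eq_Some)
    then show ?thesis by (simp add: m'_def)
  next
    case False
    then have "j < p" using that by simp
    then have "m \<le> b" using w that(1,3) by (simp add: walker_def)
    then show ?thesis using m'_le by simp
  qed
  \<comment> \<open>The offsets below \<open>n\<close> cover all homes, so after one lap the least
    ID has been seen.\<close>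
  have m'_Min: "m' = Min A" if "n \<le> p"
  proof -
    obtain j where "j < n" "hm (Min A) = (hm a + j) mod n" by (rule home_offset[OF a Min_in_A])
    then have "m' \<le> Min A" using least[OF Min_in_A, of j] that by simp
    then show ?thesis using Min_le[OF finite_A m'_A] by simp
  qed
  have home_iff: "h = Some a \<longleftrightarrow> p = 0 \<or> p = n" if "p \<le> n"
  proof -
    have "h = Some a \<longleftrightarrow> (hm a + 0) mod n = (hm a + p) mod n"
      using a hm_less[OF a] by (auto simp: h_def mark_eq_Some)
    also have "\<dots> \<longleftrightarrow> p = 0 \<or> p = n"
      using that add_mod_inject[of "hm a" 0 n p] n_ge2 by auto
    finally show ?thesis .
  qed
  have p_le: "p \<le> n + offset a" using w by (simp add: walker_def)
  \<comment> \<open>After the present board has been read, the phase bounds on \<open>p\<close> are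
    sharp.\<close>
  have l': "case l' of At_Home \<Rightarrow> p = 0 | Away \<Rightarrow> 1 \<le> p \<and> p < n | Returned \<Rightarrow> n \<le> p"
    using w home_iff n_ge2 by (cases l) (auto simp: l'_def walker_def)
  \<comment> \<open>Since \<open>p - n \<le> offset a < n\<close>, the second lap meets the home of
    \<open>Min A\<close> only at its end.\<close>
  have "h = Some (Min A) \<longleftrightarrow> p = n + offset a" if "n \<le> p"
  proof -
    have "h = Some (Min A) \<longleftrightarrow> (hm a + offset a) mod n = (hm a + p) mod n"
      using offset_eq[OF a] Min_in_A by (auto simp: h_def mark_eq_Some target_def)
    also have "(hm a + p) mod n = (hm a + (p - n)) mod n"
      using that mod_add_self2[of "hm a + (p - n)" n] by simp
    also have "(hm a + offset a) mod n = \<dots> \<longleftrightarrow> offset a = p - n"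
      using add_mod_inject[of "hm a" "offset a" n "p - n"] offset_less[of a] p_le by auto
    finally show ?thesis using that by auto
  qed
  then show "l' = Returned \<and> h = Some m' \<longleftrightarrow> p = n + offset a"
    using l' m'_Min n_ge2 by (cases l') auto
  have seen: "\<forall>b\<in>A. \<forall>j<p + 1. hm b = (hm a + j) mod n \<longrightarrow> m' \<le> b"
    using least by blast
  then have "\<forall>b\<in>A. \<forall>j<p. hm b = (hm a + j) mod n \<longrightarrow> m' \<le> b"
    by (metis less_SucI Suc_eq_plus1)
  then show "walker a p m' l'"
    unfolding walker_def using l' p_le m'_A by (cases l') simp_all
  show "walker a (p + 1) m' l'" if "p \<noteq> n + offset a"
  proof -
    have "p + 1 \<le> n + offset a" using p_le that by simp
    then show ?thesis
      unfolding walker_def using seen l' m'_A by (cases l') simp_all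
  qed
qed

text \<open>The clause on pairs is the heart: while two agents have not arrived and are apart, at
  least one of them moves in every round, so \<open>p a + p b\<close> grows at least as fast as
  \<open>t\<close>.\<close>

lemma walk_invariant:
  assumes "t \<le> 4 * n"
  shows "(\<forall>v. board (X (Suc t)) v = (mark v, {||})) \<and>
    (\<exists>p. (\<forall>a\<in>A. loc (X (Suc t)) a = (hm a + p a) mod n \<and>
            (\<exists>m l. state (X (Suc t)) a = Walk t m l \<and> walker a (p a) m l)) \<and>
         (\<forall>a\<in>A. \<forall>b\<in>A. p a = n + offset a \<or> p b = n + offset b \<or>
            loc (X (Suc t)) a = loc (X (Suc t)) b \<or> t \<le> p a + p b))"
  using assms
proof (induction t)
  case 0
  show ?case
    using start_round hm_less
    by (auto intro!: exI[of _ "\<lambda>_. 0"] simp: walker_def)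
next
  case (Suc t)
  from Suc.IH[OF Suc_leD[OF Suc.prems]] obtain p where board: "\<And>v. board (X (Suc t)) v = (mark v, {||})"
    and loc: "\<And>a. a \<in> A \<Longrightarrow> loc (X (Suc t)) a = (hm a + p a) mod n"
    and ex: "\<forall>a\<in>A. \<exists>m l. state (X (Suc t)) a = Walk t m l \<and> walker a (p a) m l"
    and pair: "\<And>a b. a \<in> A \<Longrightarrow> b \<in> A \<Longrightarrow> p a = n + offset a \<or> p b = n + offset b \<or>
        loc (X (Suc t)) a = loc (X (Suc t)) b \<or> t \<le> p a + p b"
    by blast
  obtain m l where st: "\<And>a. a \<in> A \<Longrightarrow> state (X (Suc t)) a = Walk t (m a) (l a)"
    and w: "\<And>a. a \<in> A \<Longrightarrow> walker a (p a) (m a) (l a)"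
    using ex by metis
  define h where "h a = mark ((hm a + p a) mod n)" for a
  define m' where "m' a = update_least (m a) (h a)" for a
  define l' where "l' a = update_lap a (l a) (h a)" for a
  define d where "d a = (if p a = n + offset a then Stay else Forward)" for a
  define p' where "p' a = (if p a = n + offset a \<or> missing E (Suc t) = Some (loc (X (Suc t)) a)
      then p a else p a + 1)" for a
  have nonfinal: "state (X (Suc t)) a \<notin> range (Sweep n)" if "a \<in> A" for a
    using st[OF that] by auto
  have step: "gather_step n k g a (state (X (Suc t)) a) (board (X (Suc t)) (loc (X (Suc t)) a)) =
      (Walk (Suc t) (m' a) (l' a), board (X (Suc t)) (loc (X (Suc t)) a), d a)"
    if "a \<in> A" for a
    using walker_step(1)[OF that w[OF that]] Suc.prems
    by (simp add: st that board loc h_def m'_def l'_def d_def Let_def)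
  note next_round = silent_round_step[OF nonfinal step, simplified]
  have loc': "loc (X (Suc (Suc t))) a = (hm a + p' a) mod n" if "a \<in> A" for a
    using next_round(2)[OF that]
    by (auto simp: loc[OF that] d_def p'_def destination_Forward)
  have w': "walker a (p' a) (m' a) (l' a)" if "a \<in> A" for a
    using walker_step(2,3)[OF that w[OF that]] by (auto simp: p'_def m'_def l'_def h_def)
  have pair': "p' a = n + offset a \<or> p' b = n + offset b \<or>
      loc (X (Suc (Suc t))) a = loc (X (Suc (Suc t))) b \<or> Suc t \<le> p' a + p' b"
    if "a \<in> A" "b \<in> A" for a b
  proof (cases "p a = n + offset a \<or> p b = n + offset b")
    case True
    then show ?thesis by (auto simp: p'_def)
  next
    case False
    then have d: "d a = Forward" "d b = Forward" by (auto simp: d_def)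
    show ?thesis
    proof (cases "loc (X (Suc t)) a = loc (X (Suc t)) b")
      case True
      \<comment> \<open>Both face the same link, so they are blocked together or move
        together.\<close>
      then show ?thesis using next_round(2) that d by simp
    next
      case neq: False
      then have "t \<le> p a + p b" using pair[OF that] False by simp
      \<comment> \<open>The single missing link cannot be the forward link of two different
        nodes.\<close>
      then show ?thesis using neq False by (auto simp: p'_def)
    qed
  qed
  show ?case
    using next_round(1,3) board loc' w' pair' by (intro conjI exI[of _ p']) auto
qed

lemma two_nodes_after_walk:
  obtains S where "\<And>a. a \<in> A \<Longrightarrow> loc (X (4 * n + 1)) a \<in> {target, S}"
proof -
  obtain p where loc: "\<And>a. a \<in> A \<Longrightarrow> loc (X (4 * n + 1)) a = (hm a + p a) mod n"
    and le: "\<And>a. a \<in> A \<Longrightarrow> p a \<le> n + offset a"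
    and pair: "\<And>a b. a \<in> A \<Longrightarrow> b \<in> A \<Longrightarrow> p a = n + offset a \<or> p b = n + offset b \<or>
        loc (X (4 * n + 1)) a = loc (X (4 * n + 1)) b \<or> 4 * n \<le> p a + p b"
    using walk_invariant[OF order_refl] unfolding walker_def Suc_eq_plus1 by blast
  have arrived: "loc (X (4 * n + 1)) a = target" if "a \<in> A" "p a = n + offset a" for a
    using loc[OF that(1)] offset_eq[OF that(1)] that(2)
    by (metis add.commute add.left_commute mod_add_self1)
  \<comment> \<open>Each summand is at most \<open>n + offset a < 2 * n\<close>. This is why
    \<open>4 * n\<close> walking rounds are enough.\<close>
  have "p a + p b < 4 * n" if "a \<in> A" "b \<in> A" for a b
    using le[OF that(1)] le[OF that(2)] offset_less[of a] offset_less[of b] by linarith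
  then have same: "loc (X (4 * n + 1)) a = loc (X (4 * n + 1)) b"
    if "a \<in> A" "b \<in> A" "loc (X (4 * n + 1)) a \<noteq> target" "loc (X (4 * n + 1)) b \<noteq> target" for a b
    using pair[of a b] arrived that by (metis not_le)
  show thesis
  proof (cases "\<exists>a\<in>A. loc (X (4 * n + 1)) a \<noteq> target")
    case True
    then obtain b where "b \<in> A" "loc (X (4 * n + 1)) b \<noteq> target" by blast
    then show thesis using same that[of "loc (X (4 * n + 1)) b"] by blast
  next
    case False
    then show thesis using that[of target] by blast
  qed
qed

subsection \<open>Splitting the larger group\<close>

definition start :: "nat \<Rightarrow> nat" where "start a = loc (X (4 * n + 1)) a"

definition group :: "nat \<Rightarrow> nat set" where "group v = {a \<in> A. start a = v}"

text \<open>The outcome of \<open>small_roster\<close> on the completed roster of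
  \<open>v\<close>.\<close>

definition small :: "nat \<Rightarrow> bool" where
  "small v \<longleftrightarrow> group v \<noteq> {} \<and> card (group v) \<le> k - g"

definition heading :: "nat \<Rightarrow> direction" where
  "heading a = (if card {x \<in> group (start a). x < a} < g then Forward else Backward)"

text \<open>A roster is a set and signing is an insertion, so the order of the signatures is
  irrelevant.\<close>

lemma enlist_round:
  shows "a \<in> A \<Longrightarrow> state (X (4 * n + 2)) a = Enlisted"
    and "a \<in> A \<Longrightarrow> loc (X (4 * n + 2)) a = start a"
    and "fset (snd (board (X (4 * n + 2)) v)) = group v"
proof -
  define u :: "nat \<Rightarrow> whiteboard \<Rightarrow> whiteboard" where "u = (\<lambda>a w. (fst w, finsert a (snd w)))"
  have st: "\<exists>m l. state (X (4 * n + 1)) a = Walk (4 * n) m l" if "a \<in> A" for a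
    using walk_invariant[of "4 * n"] that by auto
  have board: "board (X (4 * n + 1)) v = (mark v, {||})" for v
    using walk_invariant[of "4 * n"] by simp
  note * = round_step[where t = "4 * n + 1" and V = "\<lambda>_. UNIV" and u = u
      and s = "\<lambda>_. Enlisted" and d = "\<lambda>_. Stay"]
  have step: "gather_step n k g a (state (X (4 * n + 1)) a) w = (Enlisted, u a w, Stay)"
    if "a \<in> A" for a w
    using st[OF that] by (cases w) (auto simp: u_def)
  have nonfinal: "state (X (4 * n + 1)) a \<notin> range (Sweep n)" if "a \<in> A" for a
    using st[OF that] by auto
  have eq: "4 * n + 2 = Suc (4 * n + 1)" by simp
  show "a \<in> A \<Longrightarrow> state (X (4 * n + 2)) a = Enlisted"
    using *(1)[of a] step nonfinal unfolding eq by blast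
  show "a \<in> A \<Longrightarrow> loc (X (4 * n + 2)) a = start a"
    using *(2)[of a] step nonfinal unfolding eq start_def by (metis UNIV_I destination_Stay)
  have fold_u: "fset (snd (fold u ys w)) = set ys \<union> fset (snd w)" for ys w
    by (induction ys arbitrary: w) (auto simp: u_def)
  have "board (X (4 * n + 2)) v =
      fold u (filter (\<lambda>a. loc (X (4 * n + 1)) a = v) (action_order E (4 * n + 1)))
        (board (X (4 * n + 1)) v)"
    using *(3)[of v] step nonfinal unfolding eq by blast
  then show "fset (snd (board (X (4 * n + 2)) v)) = group v"
    by (simp only: fold_u) (simp add: board[simplified] set_order group_def start_def)
qed

lemma choose_round:
  shows "a \<in> A \<Longrightarrow> state (X (4 * n + 3)) a = Sweep 0 (heading a)"
    and "a \<in> A \<Longrightarrow> loc (X (4 * n + 3)) a = start a"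
    and "fset (snd (board (X (4 * n + 3)) v)) = group v"
proof -
  have eq: "4 * n + 3 = Suc (4 * n + 2)" by simp
  have nonfinal: "state (X (4 * n + 2)) a \<notin> range (Sweep n)" if "a \<in> A" for a
    using enlist_round(1)[OF that] by auto
  have step: "gather_step n k g a (state (X (4 * n + 2)) a)
      (board (X (4 * n + 2)) (loc (X (4 * n + 2)) a)) =
      (Sweep 0 (heading a), board (X (4 * n + 2)) (loc (X (4 * n + 2)) a), Stay)"
    if "a \<in> A" for a
    using enlist_round(3)[of "start a"]
    by (cases "board (X (4 * n + 2)) (start a)")
      (simp add: enlist_round(1,2)[OF that, simplified] heading_def)
  note * = silent_round_step[OF nonfinal step]
  show "a \<in> A \<Longrightarrow> state (X (4 * n + 3)) a = Sweep 0 (heading a)"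
    using *(1)[of a] unfolding eq by blast
  show "a \<in> A \<Longrightarrow> loc (X (4 * n + 3)) a = start a"
    using *(2)[of a] enlist_round(2)[of a] unfolding eq by (metis destination_Stay)
  show "fset (snd (board (X (4 * n + 3)) v)) = group v"
    using *(3) enlist_round(3)[of v] unfolding eq by metis
qed

section \<open>The sweep towards the small group\<close>

definition pos :: "nat \<Rightarrow> nat \<Rightarrow> nat" where "pos j a = loc (X (4 * n + 3 + j)) a"

text \<open>Before the sweep there are \<open>4 * n + 3\<close> rounds: one for writing IDs,
  \<open>4 * n\<close> for walking, one for signing and one for choosing a heading. Rosters no
  longer change, so the test made at a node always agrees with \<open>small\<close>.\<close>

lemma sweep_invariant:
  "j \<le> n \<Longrightarrow> (\<forall>a\<in>A. state (X (4 * n + 3 + j)) a = Sweep j (heading a)) \<and>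
     (\<forall>v. fset (snd (board (X (4 * n + 3 + j)) v)) = group v)"
  and pos_Suc: "j < n \<Longrightarrow> a \<in> A \<Longrightarrow> pos (Suc j) a =
     (if small (pos j a) then pos j a
      else destination n (missing E (4 * n + 3 + j)) (pos j a) (heading a))"
proof -
  have one_round: "(\<forall>a\<in>A. state (X (4 * n + 3 + Suc j)) a = Sweep (Suc j) (heading a)) \<and>
      board (X (4 * n + 3 + Suc j)) = board (X (4 * n + 3 + j)) \<and>
      (\<forall>a\<in>A. pos (Suc j) a = (if small (pos j a) then pos j a
        else destination n (missing E (4 * n + 3 + j)) (pos j a) (heading a)))"
    if st: "\<forall>a\<in>A. state (X (4 * n + 3 + j)) a = Sweep j (heading a)"
      and board: "\<forall>v. fset (snd (board (X (4 * n + 3 + j)) v)) = group v" and "j < n" for j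
  proof -
    have eq: "4 * n + 3 + Suc j = Suc (4 * n + 3 + j)" by simp
    define t where "t = 4 * n + 3 + j"
    have nonfinal: "state (X t) a \<notin> range (Sweep n)" if "a \<in> A" for a
      using st that \<open>j < n\<close> by (auto simp: t_def)
    have roster: "small_roster k g (snd (board (X t) v)) \<longleftrightarrow> small v" for v
    proof -
      have "fset (snd (board (X t) v)) = group v" using board by (simp add: t_def)
      then show ?thesis
        unfolding small_roster_def small_def fcard.rep_eq by (metis bot_fset.rep_eq fset_inject)
    qed
    have step: "gather_step n k g a (state (X t) a) (board (X t) (loc (X t) a)) =
        (Sweep (Suc j) (heading a), board (X t) (loc (X t) a),
         if small (pos j a) then Stay else heading a)" if "a \<in> A" for a
      using st that \<open>j < n\<close> roster[of "loc (X t) a"]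
      by (cases "board (X t) (loc (X t) a)")
        (auto simp: pos_def t_def)
    note * = silent_round_step[OF nonfinal step]
    show ?thesis
      using *(1,2,3) unfolding eq pos_def t_def[symmetric]
      by auto
  qed
  show inv: "j \<le> n \<Longrightarrow> (\<forall>a\<in>A. state (X (4 * n + 3 + j)) a = Sweep j (heading a)) \<and>
     (\<forall>v. fset (snd (board (X (4 * n + 3 + j)) v)) = group v)" for j
  proof (induction j)
    case 0
    show ?case using choose_round by simp
  next
    case (Suc j)
    then show ?case using one_round[of j] by (metis Suc_leD Suc_le_lessD)
  qed
  show "j < n \<Longrightarrow> a \<in> A \<Longrightarrow> pos (Suc j) a = (if small (pos j a) then pos j a
      else destination n (missing E (4 * n + 3 + j)) (pos j a) (heading a))"
    using one_round[of j] inv[of j] by simp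
qed

lemma pos_0: "a \<in> A \<Longrightarrow> pos 0 a = start a"
  using choose_round(2) by (simp add: pos_def)

text \<open>Such agents read the same roster and face the same link in every round.\<close>

lemma pos_same:
  assumes "a \<in> A" "b \<in> A" "start a = start b" "heading a = heading b" "j \<le> n"
  shows "pos j a = pos j b"
  using \<open>j \<le> n\<close> by (induction j) (simp_all add: pos_0 pos_Suc assms)

lemma pos_small:
  assumes "a \<in> A" "small (start a)" "j \<le> n"
  shows "pos j a = start a"
  using \<open>j \<le> n\<close> by (induction j) (simp_all add: pos_0 pos_Suc assms)

lemma start_less: "a \<in> A \<Longrightarrow> start a < n"
  using walk_invariant[of "4 * n"] n_ge2 by (auto simp: start_def)

lemma finite_group: "finite (group v)"
  using finite_A by (simp add: group_def)

text \<open>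
  The two halves of the large group at \<open>L\<close> approach the node \<open>S\<close> of the small group over disjoint
  arcs, so that in every round before an arrival at least one of them advances.
\<close>

lemma sweep_reaches:
  assumes "L < n" "S < n" "L \<noteq> S" and small_iff: "\<And>v. small v \<longleftrightarrow> v = S"
  shows "(\<forall>a\<in>group L. heading a = Forward \<longrightarrow> pos n a = S) \<or>
         (\<forall>a\<in>group L. heading a = Backward \<longrightarrow> pos n a = S)"
proof -
  define q where "q = (S + n - L) mod n"
  have q: "q < n" "S = (L + q) mod n"
    using assms by (auto simp: q_def mod_simps)
  have q_pos: "0 < q" using q assms by (cases "q = 0") auto
  \<comment> \<open>The value \<open>x = n\<close> is included because the backward half starts at
    \<open>L\<close> with offset \<open>n\<close>.\<close>
  have at_S: "small ((L + x) mod n) \<longleftrightarrow> x = q" if "x \<le> n" for x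
  proof -
    have "small ((L + x) mod n) \<longleftrightarrow> (L + x mod n) mod n = (L + q) mod n"
      using small_iff q(2) by (simp add: mod_simps)
    also have "\<dots> \<longleftrightarrow> x mod n = q" using add_mod_inject[of L "x mod n" n q] q(1) by auto
    also have "\<dots> \<longleftrightarrow> x = q" using that q(1) q_pos by (cases "x = n") auto
    finally show ?thesis .
  qed
  \<comment> \<open>The forward half is at offset \<open>f\<close>, rising from \<open>0\<close> to
    \<open>q\<close>, and the backward half at \<open>r\<close>, falling from \<open>n\<close> to
    \<open>q\<close>. Until one arrives, their progress \<open>f + (n - r)\<close> is at least
    \<open>j\<close>.\<close>
  have "\<exists>f r. f \<le> q \<and> q \<le> r \<and> r \<le> n \<and> (f = q \<or> r = q \<or> j + r \<le> f + n) \<and>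
      (\<forall>a\<in>group L. pos j a = (L + (if heading a = Forward then f else r)) mod n)"
    if "j \<le> n" for j
    using that
  proof (induction j)
    case 0
    show ?case
      using q assms(1) by (intro exI[of _ 0] exI[of _ n]) (auto simp: group_def pos_0)
  next
    case (Suc j)
    then obtain f r where fr: "f \<le> q" "q \<le> r" "r \<le> n" "f = q \<or> r = q \<or> j + r \<le> f + n"
      and pos: "\<And>a. a \<in> group L \<Longrightarrow>
        pos j a = (L + (if heading a = Forward then f else r)) mod n"
      by auto
    define e where "e = missing E (4 * n + 3 + j)"
    define f' where "f' = (if f = q \<or> e = Some ((L + f) mod n) then f else f + 1)"
    define r' where "r' = (if r = q \<or> e = Some ((L + (r - 1)) mod n) then r else r - 1)"
    have "f' = q \<or> r' = q \<or> Suc j + r' \<le> f' + n"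
    proof (cases "f = q \<or> r = q")
      case True
      then show ?thesis by (auto simp: f'_def r'_def)
    next
      case False
      then have "f < q" "q < r" and sum: "j + r \<le> f + n" using fr by auto
      \<comment> \<open>These are the links that the two halves try to use; they differ because
        \<open>f < q \<le> r - 1 < n\<close>.\<close>
      then have "(L + f) mod n \<noteq> (L + (r - 1)) mod n"
        using add_mod_inject[of L f n "r - 1"] fr q(1) by fastforce
      then have "f' = f + 1 \<and> r' \<le> r \<or> f' = f \<and> r' = r - 1"
        using False by (simp add: f'_def r'_def)
      then show ?thesis using sum \<open>q < r\<close> by linarith
    qed
    moreover have "f' \<le> q" "q \<le> r'" "r' \<le> n" using fr unfolding f'_def r'_def by auto
    moreover have "pos (Suc j) a = (L + (if heading a = Forward then f' else r')) mod n"
      if "a \<in> group L" for a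
    proof -
      have "a \<in> A" using that by (simp add: group_def)
      have r: "0 < r" "0 < n" using fr q_pos q(1) by auto
      have "heading a = Forward \<or> heading a = Backward" by (simp add: heading_def)
      then show ?thesis
        using pos_Suc[of j a] \<open>a \<in> A\<close> Suc.prems pos[OF that] at_S[of f] at_S[of r] fr q(1)
          destination_Forward[of n e L f] destination_Backward[OF r, of e L]
        by (auto simp: e_def[symmetric] f'_def r'_def)
    qed
    ultimately show ?case by blast
  qed
  from this[of n] obtain f r where "f \<le> q" "q \<le> r" "f = q \<or> r = q \<or> n + r \<le> f + n"
    and "\<forall>a\<in>group L. pos n a = (L + (if heading a = Forward then f else r)) mod n"
    by auto
  \<comment> \<open>The third alternative gives \<open>r \<le> f\<close>, which together with
    \<open>f \<le> q \<le> r\<close> leaves only \<open>f = q = r\<close>.\<close>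
  then have "f = q \<or> r = q" by auto
  then show ?thesis
    using \<open>\<forall>a\<in>group L. _\<close> q(2) by auto
qed

text \<open>Either all groups are small and stay, or a large group splits into \<open>F\<close> and
  \<open>B\<close>, each of size at least \<open>g\<close> and each moving as one. An agent outside
  the large group is joined by \<open>F\<close> or by \<open>B\<close>.\<close>

lemma gathered_after_sweep:
  assumes "a \<in> A"
  shows "g \<le> card {b \<in> A. pos n b = pos n a}"
proof -
  obtain S0 where two: "\<And>a. a \<in> A \<Longrightarrow> start a \<in> {target, S0}"
    using two_nodes_after_walk unfolding start_def by metis
  have third: "start z = start x"
    if "x \<in> A" "y \<in> A" "z \<in> A" "start x \<noteq> start y" "start z \<noteq> start y" for x y z
    using two[OF that(1)] two[OF that(2)] two[OF that(3)] that(4,5) by auto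
  have bound: "g \<le> card {b \<in> A. pos n b = v}"
    if "B \<subseteq> A" "g \<le> card B" "\<And>b. b \<in> B \<Longrightarrow> pos n b = v" for B v
  proof -
    have "card B \<le> card {b \<in> A. pos n b = v}"
      using that finite_A by (intro card_mono) auto
    then show ?thesis using that(2) by simp
  qed
  have complement: "card (group v) + card (A - group v) = k" for v
  proof -
    have "group v \<subseteq> A" by (auto simp: group_def)
    then have "A = group v \<union> (A - group v)" by blast
    then show ?thesis
      using card_Un_disjoint[of "group v" "A - group v"] finite_group finite_A card_A
      by (metis Diff_disjoint finite_Diff)
  qed
  show ?thesis
  proof (cases "\<forall>b\<in>A. small (start b)")
    case True
    \<comment> \<open>A small group lacks at least \<open>g\<close> agents, so there is a second
      one; being small too, it leaves at least \<open>g\<close> agents for the group of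
      \<open>a\<close>.\<close>
    have "group (start a) \<noteq> A"
      using True assms card_A g_pos g_less by (auto simp: small_def)
    then obtain b where b: "b \<in> A" "start b \<noteq> start a" by (auto simp: group_def)
    have "A - group (start b) \<subseteq> group (start a)"
      using third[OF assms b(1)] b(2) by (auto simp: group_def)
    then have "card (A - group (start b)) \<le> card (group (start a))"
      by (rule card_mono[OF finite_group])
    moreover have "card (group (start b)) \<le> k - g" using True b by (simp add: small_def)
    ultimately have "g \<le> card (group (start a))"
      using complement[of "start b"] g_less by linarith
    then show ?thesis
      using pos_small True assms by (intro bound[of "group (start a)"]) (auto simp: group_def)
  next
    case False
    then obtain b where b: "b \<in> A" "\<not> small (start b)" by blast
    define L where "L = start b"
    have large: "k - g < card (group L)"
      using b by (auto simp: small_def L_def group_def)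
    define F where "F = {a \<in> group L. heading a = Forward}"
    define B where "B = {a \<in> group L. heading a = Backward}"
    have "F = {a \<in> group L. card {x \<in> group L. x < a} < g}"
      by (auto simp: F_def heading_def group_def)
    then have card_F: "card F = g"
      using card_rank_less[OF finite_group, of L g] large k_ge by (simp add: min_def)
    have "group L = F \<union> B" "F \<inter> B = {}" by (auto simp: F_def B_def heading_def)
    then have "card (group L) = card F + card B"
      using finite_group[of L] by (simp add: card_Un_disjoint)
    \<comment> \<open>Here \<open>3 * g - 1 \<le> k\<close> enters: the large group has at least
      \<open>k - g + 1 \<ge> 2 * g\<close> members.\<close>
    then have card_B: "g \<le> card B" using card_F large k_ge by linarith
    have FB: "F \<subseteq> A" "B \<subseteq> A" by (auto simp: F_def B_def group_def)
    show ?thesis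
    proof (cases "start a = L")
      \<comment> \<open>Wherever its part ends up, the agent is together with all of that part. This
        includes the case that everybody started the sweep at \<open>L\<close>.\<close>
      case True
      then have "a \<in> F \<or> a \<in> B" using assms by (auto simp: F_def B_def group_def heading_def)
      then show ?thesis
      proof
        assume "a \<in> F"
        then have "pos n c = pos n a" if "c \<in> F" for c
          using that by (intro pos_same) (auto simp: F_def group_def)
        then show ?thesis using bound[OF FB(1)] card_F by simp
      next
        assume "a \<in> B"
        then have "pos n c = pos n a" if "c \<in> B" for c
          using that by (intro pos_same) (auto simp: B_def group_def)
        then show ?thesis using bound[OF FB(2) card_B] by simp
      qed
    next
      case False
      define S where "S = start a"
      have "group S \<subseteq> A - group L" using False by (auto simp: group_def S_def)
      then have "card (group S) \<le> card (A - group L)"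
        using finite_A by (intro card_mono) auto
      \<comment> \<open>Fewer than \<open>g\<close> agents are outside \<open>group L\<close>, and
        \<open>g \<le> k - g\<close>.\<close>
      then have "card (group S) \<le> k - g"
        using complement[of L] large k_ge g_pos by linarith
      then have "small S" using assms by (auto simp: small_def group_def S_def)
      moreover have "v = S" if "small v" for v
      proof -
        obtain c where c: "c \<in> A" "start c = v"
          using \<open>small v\<close> by (auto simp: small_def group_def)
        have "v \<noteq> L" using that b by (auto simp: L_def)
        then show ?thesis using third[OF assms b(1) c(1)] c(2) False by (simp add: L_def S_def)
      qed
      ultimately have small_iff: "small v \<longleftrightarrow> v = S" for v by blast
      have "(\<forall>c\<in>group L. heading c = Forward \<longrightarrow> pos n c = S) \<or>
         (\<forall>c\<in>group L. heading c = Backward \<longrightarrow> pos n c = S)"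
        using start_less assms b False small_iff
        by (intro sweep_reaches) (auto simp: L_def S_def)
      moreover have "pos n a = S"
        using pos_small[OF assms] small_iff by (simp add: S_def)
      ultimately have "(\<forall>c\<in>F. pos n c = pos n a) \<or> (\<forall>c\<in>B. pos n c = pos n a)"
        by (auto simp: F_def B_def)
      then show ?thesis
        using bound[OF FB(1), of "pos n a"] bound[OF FB(2), of "pos n a"] card_F card_B by auto
    qed
  qed
qed

section \<open>Termination and the number of rounds\<close>

lemma all_terminated_iff:
  assumes "t \<le> 5 * n + 3"
  shows "all_terminated (gather n k g) E (X t) \<longleftrightarrow> t = 5 * n + 3"
proof -
  obtain a where a: "a \<in> A" using A_nonempty by blast
  \<comment> \<open>As \<open>rounds\<close> is a least time, termination before
    \<open>5 * n + 3\<close> must be excluded; one running agent suffices, and the cases are the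
    phases of the algorithm.\<close>
  have running: "state (X t) a \<notin> range (Sweep n)" if "t < 5 * n + 3"
  proof -
    consider "t = 0" | t' where "t = Suc t'" "t' \<le> 4 * n" | "t = 4 * n + 2"
      | j where "t = 4 * n + 3 + j" "j < n"
    proof (cases "t \<le> 4 * n + 2")
      case True
      then show ?thesis using that(1-3) by (cases t) force+
    next
      case False
      then show ?thesis using that(4)[of "t - (4 * n + 3)"] \<open>t < 5 * n + 3\<close> by simp
    qed
    then show ?thesis
    proof cases
      case 1
      then show ?thesis by (auto simp: execution.simps initial_config_def gather_def)
    next
      case 2
      then show ?thesis using walk_invariant[of t'] a by auto
    next
      case 3
      then show ?thesis using enlist_round(1)[OF a] by auto
    next
      case 4
      then show ?thesis using sweep_invariant[of j] a by auto
    qed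
  qed
  have "5 * n + 3 = 4 * n + 3 + n" by simp
  then have "state (X (5 * n + 3)) a \<in> range (Sweep n)" if "a \<in> A" for a
    using sweep_invariant[of n] that by (metis order_refl rangeI)
  moreover have "all_terminated (gather n k g) E C \<longleftrightarrow> (\<forall>a\<in>A. state C a \<in> range (Sweep n))" for C
    by (simp add: all_terminated_def gather_def)
  ultimately show ?thesis using running assms a by (metis le_neq_implies_less)
qed

lemma rounds_eq: "rounds (gather n k g) n E = 5 * n + 3"
  unfolding rounds_def
proof (rule Least_equality)
  show "all_terminated (gather n k g) E (X (5 * n + 3))" by (simp add: all_terminated_iff)
  show "5 * n + 3 \<le> t" if "all_terminated (gather n k g) E (X t)" for t
    using that all_terminated_iff[of t] by linarith
qed

lemma partially_gathered_final: "partially_gathered g E (final_config (gather n k g) n E)"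
proof -
  have "5 * n + 3 = 4 * n + 3 + n" by simp
  then have "loc (final_config (gather n k g) n E) = pos n"
    unfolding final_config_def rounds_eq pos_def by (simp add: fun_eq_iff)
  then show ?thesis
    using gathered_after_sweep by (auto simp: partially_gathered_def)
qed

end

theorem theorem5:
  "\<exists>(alg :: nat \<Rightarrow> nat \<Rightarrow> nat \<Rightarrow> (nat, nat) program) (c :: nat).
     \<forall>n k g. 0 < g \<and> g < k \<and> k \<le> n \<and> 3 * g - 1 \<le> k \<and> k \<le> 8 * g - 4 \<longrightarrow>
       finite_automata (alg n k g) \<and>
       solves_partial_gathering (alg n k g) n k g \<and>
       (\<forall>E. valid_scenario n k E \<longrightarrow>
          rounds (alg n k g) n E \<le> c * n \<and>
          moves (final_config (alg n k g) n E) \<le> c * (k * n))"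
proof (intro exI[of _ "\<lambda>n k g. encode_program (gather n k g)"] exI[of _ 8] allI impI)
  fix n k g :: nat
  assume params: "0 < g \<and> g < k \<and> k \<le> n \<and> 3 * g - 1 \<le> k \<and> k \<le> 8 * g - 4"
  have gathering: "gathering n k g E" if "valid_scenario n k E" for E
    using that params by unfold_locales auto
  \<comment> \<open>The constant \<open>8\<close> absorbs the three additional rounds, as
    \<open>n\<close> is positive.\<close>
  have linear: "5 * n + 3 \<le> 8 * n" using params by linarith
  have "moves (final_config (gather n k g) n E) \<le> 8 * (k * n)" if "valid_scenario n k E" for E
  proof -
    have "moves (final_config (gather n k g) n E) \<le> k * (5 * n + 3)"
      unfolding final_config_def gathering.rounds_eq[OF gathering[OF that]]
      by (rule moves_execution[OF that])
    also have "\<dots> \<le> k * (8 * n)" using linear by (rule mult_le_mono2)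
    finally show ?thesis by simp
  qed
  moreover have "solves_partial_gathering (gather n k g) n k g"
    unfolding solves_partial_gathering_def
    using gathering.all_terminated_iff[OF gathering] gathering.partially_gathered_final[OF gathering]
    by blast
  ultimately show "finite_automata (encode_program (gather n k g)) \<and>
       solves_partial_gathering (encode_program (gather n k g)) n k g \<and>
       (\<forall>E. valid_scenario n k E \<longrightarrow>
          rounds (encode_program (gather n k g)) n E \<le> 8 * n \<and>
          moves (final_config (encode_program (gather n k g)) n E) \<le> 8 * (k * n))"
    using finite_automata_encode_program[OF finite_automata_gather] linear
      gathering.rounds_eq[OF gathering]
    by (simp add: solves_partial_gathering_encode_program rounds_encode_program
        final_config_encode_program moves_encode_config)
qed

end
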